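(* Fix an integer $r \geq 3$ and, for each $n \geq 1$, let $\mathcal{A}_n$ be uniformly distributed on $\mathcal{M}(n,r)$. Let $S_n := \inf\{k \geq 1 : \chi_k(\mathcal{A}_n) > 0\}$. Then $\mathbb{P}(S_n = n) \longrightarrow 1$ as $n \to \infty$.
   Context: For integers $n \geq 1$, $r \geq 0$, $\mathcal{M}(n,r)$ is the (finite) set of $n \times n$ matrices $A = (a_{ij})$ with non-negative integer entries all of whose row sums and column sums equal $r$. Each $A \in \mathcal{M}(n,r)$ is identified with the labelled $r$-regular bipartite multigraph $G_A$ on vertices $\{R_1,\ldots,R_n\} \cup \{C_1,\ldots,C_n\}$ having exactly $a_{ij}$ edges between $R_i$ and $C_j$. A $k$-component of $A$ is a pair $(S,T)$ of non-empty subsets of $\{1,\ldots,n\}$ with $|S| = |T| = k$ such that the submatrix $(a_{ij})_{i\in S, j \in T}$ has all row and column sums equal to $r$. A component is irreducible if no other component $(S',T') \neq (S,T)$ satisfies $S' \subseteq S$, $T' \subseteq T$. $\chi_k(A)$ denotes the number of irreducible $k$-components of $A$, equivalently the number of connected components of $G_A$ having exactly $2k$ vertices; $\chi_k(A) = 0$ for $k > n$. *)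

theory Defs
  imports "HOL-Probability.Probability_Mass_Function" "Jordan_Normal_Form.Matrix"
begin

text \<open>Rows and columns are indexed by \<open>{..<n}\<close>, as usual for \<^typ>\<open>'a mat\<close>.\<close>

definition regular_matrices :: "nat \<Rightarrow> nat \<Rightarrow> nat mat set" where
  "regular_matrices n r = {A \<in> carrier_mat n n.
     (\<forall>i<n. (\<Sum>j<n. A $$ (i, j)) = r) \<and> (\<forall>j<n. (\<Sum>i<n. A $$ (i, j)) = r)}"

definition component :: "nat \<Rightarrow> nat \<Rightarrow> nat mat \<Rightarrow> nat \<Rightarrow> nat set \<Rightarrow> nat set \<Rightarrow> bool" where
  "component n r A k S T \<longleftrightarrow>
     S \<noteq> {} \<and> T \<noteq> {} \<and> S \<subseteq> {..<n} \<and> T \<subseteq> {..<n} \<and> card S = k \<and> card T = k \<and>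
     (\<forall>i\<in>S. (\<Sum>j\<in>T. A $$ (i, j)) = r) \<and> (\<forall>j\<in>T. (\<Sum>i\<in>S. A $$ (i, j)) = r)"

definition irreducible_component ::
    "nat \<Rightarrow> nat \<Rightarrow> nat mat \<Rightarrow> nat \<Rightarrow> nat set \<Rightarrow> nat set \<Rightarrow> bool" where
  "irreducible_component n r A k S T \<longleftrightarrow> component n r A k S T \<and>
     \<not> (\<exists>k' S' T'. component n r A k' S' T' \<and> (S', T') \<noteq> (S, T) \<and> S' \<subseteq> S \<and> T' \<subseteq> T)"

definition num_irreducible_components :: "nat \<Rightarrow> nat \<Rightarrow> nat \<Rightarrow> nat mat \<Rightarrow> nat" where
  "num_irreducible_components n r k A = card {(S, T). irreducible_component n r A k S T}"

text \<open>The infimum is taken over a non-empty set if \<open>n \<ge> 1\<close> and \<open>A\<close> is in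
  \<open>regular_matrices n r\<close>, see \<open>irreducible_component_sizes_nonempty\<close> below.\<close>

definition least_component_size :: "nat \<Rightarrow> nat \<Rightarrow> nat mat \<Rightarrow> nat" where
  "least_component_size n r A = Inf {k. 1 \<le> k \<and> num_irreducible_components n r k A > 0}"

text \<open>\<^const>\<open>pmf_of_set\<close> is only meaningful for finite non-empty sets.\<close>

lemma finite_regular_matrices: "finite (regular_matrices n r)"
proof (rule finite_subset)
  let ?F = "({..<n} \<times> {..<n}) \<rightarrow>\<^sub>E {..r}"
  show "finite (mat n n ` ?F)"
    by (intro finite_imageI finite_PiE) auto
  show "regular_matrices n r \<subseteq> mat n n ` ?F"
  proof
    fix A assume A: "A \<in> regular_matrices n r"
    let ?f = "restrict (\<lambda>p. A $$ p) ({..<n} \<times> {..<n})"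
    have "A $$ (i, j) \<le> r" if "i < n" "j < n" for i j
    proof -
      have "A $$ (i, j) \<le> (\<Sum>j<n. A $$ (i, j))"
        using that by (intro member_le_sum) auto
      then show ?thesis using A that by (auto simp: regular_matrices_def)
    qed
    then have "?f \<in> ?F" by auto
    moreover have "A = mat n n ?f"
      using A by (intro eq_matI) (auto simp: regular_matrices_def)
    ultimately show "A \<in> mat n n ` ?F" by blast
  qed
qed

lemma regular_matrices_nonempty: "regular_matrices n r \<noteq> {}"
proof -
  have "mat n n (\<lambda>(i, j). if i = j then r else 0) \<in> regular_matrices n r"
    by (auto simp: regular_matrices_def)
  then show ?thesis by blast
qed

lemma irreducible_component_sizes_nonempty:
  assumes "A \<in> regular_matrices n r" "n \<ge> 1"
  shows "{k. 1 \<le> k \<and> num_irreducible_components n r k A > 0} \<noteq> {}"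
proof -
  let ?P = "\<lambda>k. \<exists>S T. component n r A k S T"
  have "component n r A n {..<n} {..<n}"
    using assms by (auto simp: component_def regular_matrices_def lessThan_empty_iff)
  then have "?P n" by blast
  define k where "k = (LEAST k. ?P k)"
  obtain S T where c: "component n r A k S T"
    using LeastI[of ?P, OF \<open>?P n\<close>] unfolding k_def by blast
  have least: "k \<le> k'" if "component n r A k' S' T'" for k' S' T'
    unfolding k_def using that by (intro Least_le) blast
  have "(S', T') = (S, T)"
    if c': "component n r A k' S' T'" and sub: "S' \<subseteq> S" "T' \<subseteq> T" for k' S' T'
  proof -
    have fin: "finite S" "finite T"
      using c finite_subset[OF _ finite_lessThan] by (auto simp: component_def)
    have "card S \<le> card S'" "card T \<le> card T'"
      using least[OF c'] c c' by (auto simp: component_def)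
    then show ?thesis
      using card_seteq[OF fin(1) sub(1)] card_seteq[OF fin(2) sub(2)] by simp
  qed
  then have irr: "irreducible_component n r A k S T"
    using c by (auto simp: irreducible_component_def)
  have "{(S, T). irreducible_component n r A k S T} \<subseteq> Pow {..<n} \<times> Pow {..<n}"
    by (auto simp: irreducible_component_def component_def)
  then have "finite {(S, T). irreducible_component n r A k S T}"
    by (rule finite_subset) simp
  then have "num_irreducible_components n r k A > 0"
    using irr by (auto simp: num_irreducible_components_def card_gt_0_iff)
  moreover have "k \<ge> 1"
    using c finite_subset[OF _ finite_lessThan]
    by (auto simp: component_def Suc_le_eq card_gt_0_iff)
  ultimately show ?thesis by blast
qed

end

theory Submission
  imports Defs
begin

text \<open>
  A matrix whose least component size is not \<open>n\<close> has a component \<open>(S, T)\<close> with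
  \<open>1 \<le> k = \<bar>S\<bar> < n\<close>. Regularity forces the entries outside the two diagonal blocks
  \<open>S \<times> T\<close> and \<open>(- S) \<times> (- T)\<close> to vanish, so with \<open>M n\<close> the number of
  \<open>n \<times> n\<close> matrices in question there are at most
  \<open>(\<Sum>k=1..<n. (n choose k)\<^sup>2 * M k * M (n - k))\<close> such matrices
  (\<open>card_matrices_with_component_le\<close>). It remains to see that this is
  \<open>O(M n / n)\<close>.

  The point is that \<open>M n\<close> agrees with \<open>W n = (r n)! / (r!)\<^bsup>2n\<^esup>\<close> up to a
  factor that depends on \<open>r\<close> alone. If every table \<open>A\<close> is weighted by
  \<open>\<Prod> 1 / A\<^sub>i\<^sub>j!\<close>, the total weight is known exactly for arbitrary margins
  (\<open>sum_weight_tables\<close>); in the regular case it is \<open>W n\<close>. As weights are at most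
  \<open>1\<close>, this gives \<open>W n \<le> M n\<close>. For the reverse bound, split a table into its heavy part
  (the entries that are at least \<open>2\<close>) and a remainder with entries \<open>0\<close> and \<open>1\<close>. The
  remainder has weight \<open>1\<close>, so the exact formula bounds the number of remainders for a given
  heavy part \<open>K\<close>, by \<open>W n * (e r / n)\<^bsup>\<bar>K\<bar>\<^esup>\<close> where \<open>\<bar>K\<bar>\<close> is
  the sum of the entries. Summed over all \<open>K\<close> this factorises over the \<open>n\<^sup>2\<close> cells,
  and every cell contributes \<open>1 + O(1 / n\<^sup>2)\<close> because its entry in \<open>K\<close> is
  never \<open>1\<close>; the product is therefore bounded (\<open>card_regular_tables_le\<close>).

  Consequently the summand for \<open>k\<close>, divided by \<open>M n\<close>, is at most a constant times
  \<open>(n choose k)\<^sup>2 * W k * W (n - k) / W n = (n choose k)\<^sup>2 / (r n choose r k)\<close>. Since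
  \<open>(n choose k)\<^sup>r \<le> (r n choose r k)\<close> and \<open>r \<ge> 3\<close>, this is at most
  \<open>1 / (n choose k)\<close>, and these reciprocals sum to at most \<open>4 / n\<close>
  (\<open>sum_inverse_binomial_le\<close>).
\<close>

section \<open>Contingency tables and their total weight\<close>

text \<open>Row and column indices range over arbitrary finite sets, so that the diagonal blocks of a
  matrix need no relabelling; extensionality makes a table determined by its cells.\<close>

definition contingency_tables :: "'a set \<Rightarrow> 'b set \<Rightarrow> ('a \<Rightarrow> nat) \<Rightarrow> ('b \<Rightarrow> nat) \<Rightarrow> ('a \<times> 'b \<Rightarrow> nat) set" where
  "contingency_tables I J s c = {A \<in> extensional (I \<times> J).
     (\<forall>i\<in>I. (\<Sum>j\<in>J. A (i, j)) = s i) \<and> (\<forall>j\<in>J. (\<Sum>i\<in>I. A (i, j)) = c j)}"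

lemma tables_le_row:
  assumes "A \<in> contingency_tables I J s c" "finite J" "i \<in> I" "j \<in> J"
  shows "A (i, j) \<le> s i"
proof -
  have "A (i, j) \<le> (\<Sum>j\<in>J. A (i, j))"
    using assms by (intro member_le_sum) auto
  then show ?thesis using assms by (auto simp: contingency_tables_def)
qed

lemma tables_le_col:
  assumes "A \<in> contingency_tables I J s c" "finite I" "i \<in> I" "j \<in> J"
  shows "A (i, j) \<le> c j"
proof -
  have "A (i, j) \<le> (\<Sum>i\<in>I. A (i, j))"
    using assms by (intro member_le_sum[where f = "\<lambda>i. A (i, j)"]) auto
  then show ?thesis using assms by (auto simp: contingency_tables_def)
qed

lemma finite_tables:
  assumes "finite I" "finite J"
  shows "finite (contingency_tables I J s c)"
proof (rule finite_subset)
  show "contingency_tables I J s c \<subseteq> (\<Pi>\<^sub>E p\<in>I \<times> J. {..s (fst p)})"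
    using assms by (auto simp: PiE_def tables_le_row) (auto simp: contingency_tables_def)
  show "finite (\<Pi>\<^sub>E p\<in>I \<times> J. {..s (fst p)})"
    using assms by (intro finite_PiE) auto
qed

lemma increment_mem_tables_iff:
  assumes "finite I" "finite J" "i \<in> I" "j \<in> J"
  shows "A((i, j) := Suc (A (i, j))) \<in> contingency_tables I J (s(i := Suc (s i))) (c(j := Suc (c j)))
     \<longleftrightarrow> A \<in> contingency_tables I J s c"
proof -
  let ?B = "A((i, j) := Suc (A (i, j)))"
  have B: "?B (i', j') = A (i', j') + (if i' = i then if j' = j then 1 else 0 else 0)" for i' j'
    by auto
  have row: "(\<Sum>j'\<in>J. ?B (i', j')) = (\<Sum>j'\<in>J. A (i', j')) + (if i' = i then 1 else 0)" for i'
    unfolding B sum.distrib using assms by simp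
  have col: "(\<Sum>i'\<in>I. ?B (i', j')) = (\<Sum>i'\<in>I. A (i', j')) + (if j' = j then 1 else 0)" for j'
    unfolding B sum.distrib using assms by (simp add: sum.delta)
  have ext: "?B \<in> extensional (I \<times> J) \<longleftrightarrow> A \<in> extensional (I \<times> J)"
    using assms by (auto simp: extensional_def)
  have "(\<forall>i'\<in>I. (\<Sum>j'\<in>J. ?B (i', j')) = (s(i := Suc (s i))) i') \<longleftrightarrow>
        (\<forall>i'\<in>I. (\<Sum>j'\<in>J. A (i', j')) = s i')"
    unfolding row by (intro ball_cong) auto
  moreover have "(\<forall>j'\<in>J. (\<Sum>i'\<in>I. ?B (i', j')) = (c(j := Suc (c j))) j') \<longleftrightarrow>
        (\<forall>j'\<in>J. (\<Sum>i'\<in>I. A (i', j')) = c j')"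
    unfolding col by (intro ball_cong) auto
  ultimately show ?thesis
    unfolding contingency_tables_def mem_Collect_eq ext by argo
qed

text \<open>For fixed margins and up to normalisation, this is the probability of \<open>A\<close> in the configuration model:
  if \<open>N\<close> labelled units, distributed over the rows, are matched at random with \<open>N\<close>
  labelled units distributed over the columns, the number of matchings that induce \<open>A\<close> is
  proportional to \<open>weight (I \<times> J) A\<close>.\<close>

definition weight :: "('a \<times> 'b) set \<Rightarrow> ('a \<times> 'b \<Rightarrow> nat) \<Rightarrow> real" where
  "weight P A = (\<Prod>p\<in>P. 1 / fact (A p))"

lemma weight_increment:
  assumes "finite P" "p \<in> P"
  shows "real (Suc (A p)) * weight P (A(p := Suc (A p))) = weight P A"
proof -
  have "weight P (A(p := Suc (A p))) = 1 / fact (Suc (A p)) * (\<Prod>q\<in>P - {p}. 1 / fact (A q))"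
    unfolding weight_def using assms by (subst prod.remove[of P p]) auto
  moreover have "weight P A = 1 / fact (A p) * (\<Prod>q\<in>P - {p}. 1 / fact (A q))"
    unfolding weight_def using assms by (rule prod.remove)
  ultimately show ?thesis by (simp del: of_nat_Suc)
qed

text \<open>Removing one unit from the cell \<open>(i, j)\<close> is a bijection from the tables with a
  positive entry there to the tables with margins lowered by one, and the factor \<open>A (i, j)\<close>
  is exactly what the weight gains from it.\<close>

lemma sum_weight_marked_unit:
  assumes fin: "finite I" "finite J" and ij: "i \<in> I" "j \<in> J"
  shows "(\<Sum>A\<in>contingency_tables I J (s(i := Suc (s i))) (c(j := Suc (c j))). real (A (i, j)) * weight (I \<times> J) A) =
    (\<Sum>A\<in>contingency_tables I J s c. weight (I \<times> J) A)"
proof -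
  let ?T = "contingency_tables I J (s(i := Suc (s i))) (c(j := Suc (c j)))"
  let ?inc = "\<lambda>A. A((i, j) := Suc (A (i, j)))"
  have img: "{A \<in> ?T. A (i, j) \<noteq> 0} = ?inc ` contingency_tables I J s c"
  proof (intro equalityI subsetI)
    fix A assume A: "A \<in> {A \<in> ?T. A (i, j) \<noteq> 0}"
    let ?B = "A((i, j) := A (i, j) - 1)"
    have "A = ?inc ?B" using A by (auto simp: fun_eq_iff)
    moreover from this have "?B \<in> contingency_tables I J s c"
      using A increment_mem_tables_iff[OF fin ij, of ?B] by (metis (lifting) mem_Collect_eq)
    ultimately show "A \<in> ?inc ` contingency_tables I J s c" by blast
  qed (use increment_mem_tables_iff[OF fin ij] in \<open>auto simp del: fun_upd_apply; simp\<close>)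
  have inj: "inj_on ?inc (contingency_tables I J s c)"
  proof (rule inj_onI)
    fix A B :: "'a \<times> 'b \<Rightarrow> nat" assume eq: "?inc A = ?inc B"
    show "A = B"
    proof
      fix q show "A q = B q"
        using fun_cong[OF eq, of q] by (cases "q = (i, j)") auto
    qed
  qed
  have "(\<Sum>A\<in>?T. real (A (i, j)) * weight (I \<times> J) A) =
      (\<Sum>A\<in>{A \<in> ?T. A (i, j) \<noteq> 0}. real (A (i, j)) * weight (I \<times> J) A)"
    using finite_tables[OF fin] by (intro sum.mono_neutral_right) auto
  also have "\<dots> = (\<Sum>A\<in>contingency_tables I J s c. real (Suc (A (i, j))) * weight (I \<times> J) (?inc A))"
    unfolding img sum.reindex[OF inj] by simp
  also have "\<dots> = (\<Sum>A\<in>contingency_tables I J s c. weight (I \<times> J) A)"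
    using fin ij by (intro sum.cong refl weight_increment) auto
  finally show ?thesis .
qed

text \<open>Induction on the total \<open>N\<close>: mark one of the \<open>N\<close> units in all possible ways and
  remove it. By induction, the tables with a marked unit in cell \<open>(i, j)\<close> contribute
  \<open>s i * c j\<close> times a quantity independent of the cell, and
  \<open>(\<Sum>i. \<Sum>j. s i * c j) = N\<^sup>2\<close>.\<close>

lemma sum_weight_tables:
  assumes fin: "finite I" "finite J" and "sum s I = N" "sum c J = N"
  shows "(\<Sum>A\<in>contingency_tables I J s c. weight (I \<times> J) A) =
    fact N / ((\<Prod>i\<in>I. fact (s i)) * (\<Prod>j\<in>J. fact (c j)))"
  using assms(3,4)
proof (induction N arbitrary: s c)
  case 0
  have z1: "\<And>i. i \<in> I \<Longrightarrow> s i = 0" "\<And>j. j \<in> J \<Longrightarrow> c j = 0"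
    using 0 fin by auto
  have "contingency_tables I J s c = {restrict (\<lambda>_. 0) (I \<times> J)}"
  proof (intro equalityI subsetI)
    fix A assume A: "A \<in> contingency_tables I J s c"
    have "A (i, j) = 0" if "i \<in> I" "j \<in> J" for i j
      using tables_le_row[OF A fin(2) that] z1 that by simp
    then have "A = restrict (\<lambda>_. 0) (I \<times> J)"
      using A by (auto simp: fun_eq_iff contingency_tables_def extensional_def)
    then show "A \<in> {restrict (\<lambda>_. 0) (I \<times> J)}" by simp
  qed (auto simp: contingency_tables_def z1)
  then show ?case by (simp add: weight_def z1)
next
  case (Suc N)
  let ?w = "weight (I \<times> J)"
  let ?D = "(\<Prod>i\<in>I. fact (s i)) * (\<Prod>j\<in>J. fact (c j)) :: real"
  \<comment> \<open>If a margin is zero both sides vanish, so truncated subtraction is harmless.\<close>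
  have cell: "(\<Sum>A\<in>contingency_tables I J s c. real (A (i, j)) * ?w A) = real (s i) * real (c j) * (fact N / ?D)"
    if ij: "i \<in> I" "j \<in> J" for i j
  proof (cases "s i = 0 \<or> c j = 0")
    case True
    then have "A (i, j) = 0" if "A \<in> contingency_tables I J s c" for A
      using tables_le_row[OF that fin(2) ij] tables_le_col[OF that fin(1) ij] by auto
    then have "(\<Sum>A\<in>contingency_tables I J s c. real (A (i, j)) * ?w A) = 0"
      by (intro sum.neutral) auto
    then show ?thesis using True by auto
  next
    case False
    define s' c' where "s' = s(i := s i - 1)" and "c' = c(j := c j - 1)"
    have s: "s = s'(i := Suc (s' i))" and c: "c = c'(j := Suc (c' j))"
      using False by (auto simp: s'_def c'_def)
    have "sum s I = Suc (sum s' I)" "sum c J = Suc (sum c' J)"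
      using False ij fin by (auto simp: s'_def c'_def sum.remove[of I i] sum.remove[of J j])
    then have "sum s' I = N" "sum c' J = N"
      using Suc.prems by auto
    then have "(\<Sum>A\<in>contingency_tables I J s c. real (A (i, j)) * ?w A) =
        fact N / ((\<Prod>i\<in>I. fact (s' i)) * (\<Prod>j\<in>J. fact (c' j)))"
      using sum_weight_marked_unit[OF fin ij, of s' c'] Suc.IH[of s' c'] s c by simp
    moreover have "(\<Prod>i\<in>I. fact (s i)) = real (s i) * (\<Prod>i\<in>I. fact (s' i))"
      using False ij fin fact_reduce[of "s i"]
      by (simp add: s'_def prod.remove[of I i])
    moreover have "(\<Prod>j\<in>J. fact (c j)) = real (c j) * (\<Prod>j\<in>J. fact (c' j))"
      using False ij fin fact_reduce[of "c j"]
      by (simp add: c'_def prod.remove[of J j])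
    ultimately show ?thesis using False by simp
  qed
  have total: "(\<Sum>i\<in>I. \<Sum>j\<in>J. real (A (i, j))) = real (Suc N)" if "A \<in> contingency_tables I J s c" for A
  proof -
    have "(\<Sum>i\<in>I. \<Sum>j\<in>J. A (i, j)) = Suc N"
      using that Suc.prems by (simp add: contingency_tables_def)
    from arg_cong[OF this, of real] show ?thesis by simp
  qed
  have "real (Suc N) * (\<Sum>A\<in>contingency_tables I J s c. ?w A) =
      (\<Sum>A\<in>contingency_tables I J s c. (\<Sum>i\<in>I. \<Sum>j\<in>J. real (A (i, j))) * ?w A)"
    by (simp add: sum_distrib_left total del: of_nat_Suc)
  also have "\<dots> = (\<Sum>A\<in>contingency_tables I J s c. \<Sum>i\<in>I. \<Sum>j\<in>J. real (A (i, j)) * ?w A)"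
    by (simp add: sum_distrib_right)
  also have "\<dots> = (\<Sum>i\<in>I. \<Sum>A\<in>contingency_tables I J s c. \<Sum>j\<in>J. real (A (i, j)) * ?w A)"
    by (rule sum.swap)
  also have "\<dots> = (\<Sum>i\<in>I. \<Sum>j\<in>J. \<Sum>A\<in>contingency_tables I J s c. real (A (i, j)) * ?w A)"
    by (intro sum.cong refl sum.swap)
  also have "\<dots> = (\<Sum>i\<in>I. \<Sum>j\<in>J. real (s i) * real (c j) * (fact N / ?D))"
    by (intro sum.cong refl cell)
  also have "\<dots> = (\<Sum>i\<in>I. real (s i)) * (\<Sum>j\<in>J. real (c j)) * (fact N / ?D)"
    by (simp only: sum_distrib_right[symmetric] sum_distrib_left[symmetric])
  also have "\<dots> = real (Suc N) * (fact (Suc N) / ?D)"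
  proof -
    have "(\<Sum>i\<in>I. real (s i)) = real (Suc N)" "(\<Sum>j\<in>J. real (c j)) = real (Suc N)"
      using Suc.prems by (metis of_nat_sum)+
    then show ?thesis by (simp del: of_nat_Suc)
  qed
  finally show ?case
    by (simp only: mult_cancel_left of_nat_eq_0_iff nat.distinct simp_thms)
qed

lemma card_tables_ge:
  assumes fin: "finite I" "finite J" and N: "sum s I = N" "sum c J = N"
  shows "fact N / ((\<Prod>i\<in>I. fact (s i)) * (\<Prod>j\<in>J. fact (c j))) \<le> real (card (contingency_tables I J s c))"
proof -
  have "(\<Sum>A\<in>contingency_tables I J s c. weight (I \<times> J) A) \<le> (\<Sum>A\<in>contingency_tables I J s c. 1)"
    unfolding weight_def by (intro sum_mono prod_le_1) (auto simp: fact_ge_1)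
  then show ?thesis using sum_weight_tables[OF assms] by simp
qed

lemma card_zero_one_tables_le:
  assumes fin: "finite I" "finite J" and N: "sum s I = N" "sum c J = N"
  shows "real (card {A \<in> contingency_tables I J s c. \<forall>p\<in>I \<times> J. A p \<le> 1})
    \<le> fact N / ((\<Prod>i\<in>I. fact (s i)) * (\<Prod>j\<in>J. fact (c j)))"
proof -
  let ?Z = "{A \<in> contingency_tables I J s c. \<forall>p\<in>I \<times> J. A p \<le> 1}"
  have "weight (I \<times> J) A = 1" if "A \<in> ?Z" for A
    unfolding weight_def
  proof (intro prod.neutral ballI)
    fix p assume "p \<in> I \<times> J"
    then have "A p = 0 \<or> A p = 1" using that by fastforce
    then show "1 / fact (A p) = (1 :: real)" by auto
  qed
  then have "real (card ?Z) = (\<Sum>A\<in>?Z. weight (I \<times> J) A)" by simp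
  also have "\<dots> \<le> (\<Sum>A\<in>contingency_tables I J s c. weight (I \<times> J) A)"
    using finite_tables[OF fin] by (intro sum_mono2) (auto simp: weight_def intro!: prod_nonneg)
  finally show ?thesis using sum_weight_tables[OF assms] by simp
qed

section \<open>Counting regular tables up to a constant factor\<close>

text \<open>The left-hand side, divided by \<open>fact m\<close>, is a single term of the exponential series.\<close>

lemma power_self_le_exp_mult_fact: "real m ^ m \<le> exp (real m) * fact m"
proof -
  have "(\<Sum>k\<in>{m}. real m ^ k /\<^sub>R fact k) \<le> exp (real m)"
    unfolding exp_def by (intro sum_le_suminf summable_exp_generic) auto
  then show ?thesis by (simp add: field_simps)
qed

text \<open>Taking \<open>m\<close> units away from \<open>N\<close> costs a factor of at least \<open>(N / e)\<^sup>m\<close>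
  in the factorial, since \<open>fact m\<close> times the binomial coefficient is at least
  \<open>(m / e)\<^sup>m * (N / m)\<^sup>m\<close>.\<close>

lemma fact_diff_le:
  assumes "m \<le> N"
  shows "fact (N - m) * real N ^ m \<le> exp (real m) * fact N"
proof (cases "m = 0")
  case False
  have b: "real N ^ m \<le> real (N choose m) * real m ^ m"
    using binomial_ge_n_over_k_pow_k[OF assms, where 'a = real] False
    by (simp add: field_simps power_divide)
  have "fact (N - m) * real N ^ m \<le> fact (N - m) * (real (N choose m) * (exp (real m) * fact m))"
    by (intro mult_left_mono order_trans[OF b] power_self_le_exp_mult_fact) auto
  also have "\<dots> = exp (real m) * (fact m * fact (N - m) * real (N choose m))"
    by simp
  also have "\<dots> = exp (real m) * fact N"
    by (simp only: binomial_fact_lemma[OF assms, THEN arg_cong[where f = real], simplified])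
  finally show ?thesis .
qed simp

lemma fact_le_power_mult_fact_diff:
  assumes "t \<le> r"
  shows "fact r \<le> real r ^ t * fact (r - t)"
proof -
  have "fact r div fact (r - t) \<le> r ^ t" by (rule fact_div_fact_le_pow[OF assms])
  then have "(fact r :: nat) \<le> r ^ t * fact (r - t)"
    using fact_dvd[of "r - t" r] by (metis diff_le_self dvd_div_mult_self mult_le_mono1)
  then have "real (fact r) \<le> real (r ^ t * fact (r - t))" by linarith
  then show ?thesis by simp
qed

text \<open>Subtracting the heavy part leaves a table with entries \<open>0\<close> and \<open>1\<close>, for which
  counting and weighing are the same.\<close>

definition heavy_part :: "('a \<Rightarrow> nat) \<Rightarrow> 'a \<Rightarrow> nat" where
  "heavy_part A p = (if A p \<le> 1 then 0 else A p)"

text \<open>Let \<open>m\<close> be the sum of the entries of \<open>K\<close>. Subtracting \<open>K\<close> leaves a zero-one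
  table with total \<open>r k - m\<close>. Compared with the value for full margins, lowering the total
  contributes a factor \<open>(e / (r k))\<^sup>m\<close> to the exact formula, while lowering the row margins
  and the column margins contributes at most \<open>r\<^sup>m\<close> each; the product is
  \<open>(e r / k)\<^sup>m\<close>.\<close>

lemma card_regular_tables_heavy_part_le:
  assumes fin: "finite I" "finite J" and card: "card I = k" "card J = k" and "k > 0" "r > 0"
  shows "real (card {A \<in> contingency_tables I J (\<lambda>_. r) (\<lambda>_. r). restrict (heavy_part A) (I \<times> J) = K})
    \<le> fact (r * k) / fact r ^ (2 * k) * (\<Prod>p\<in>I \<times> J. (exp 1 * real r / real k) ^ K p)"
proof -
  let ?F = "{A \<in> contingency_tables I J (\<lambda>_. r) (\<lambda>_. r). restrict (heavy_part A) (I \<times> J) = K}"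
  let ?light = "\<lambda>A. restrict (\<lambda>p. A p - K p) (I \<times> J)"
  define a b where "a = (\<lambda>i. \<Sum>j\<in>J. K (i, j))" and "b = (\<lambda>j. \<Sum>i\<in>I. K (i, j))"
  let ?m = "sum K (I \<times> J)"
  show ?thesis
  proof (cases "?F = {}")
    case True
    then show ?thesis by (simp only: True) (auto intro!: divide_nonneg_nonneg mult_nonneg_nonneg prod_nonneg)
  next
    case False
    have K: "K p = heavy_part A p" if "A \<in> ?F" "p \<in> I \<times> J" for A p
      using that by auto
    have K_le: "K p \<le> A p" "A p - K p \<le> 1" if "A \<in> ?F" "p \<in> I \<times> J" for A p
      using K[OF that] by (auto simp: heavy_part_def)
    \<comment> \<open>Any table with heavy part \<open>K\<close> shows that the margins \<open>r - a i\<close> and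
      \<open>r - b j\<close> of the remainder are not truncated.\<close>
    obtain A0 where A0: "A0 \<in> ?F" using False by blast
    have a_le: "a i \<le> r" if "i \<in> I" for i
    proof -
      have "a i \<le> (\<Sum>j\<in>J. A0 (i, j))"
        unfolding a_def using that K_le(1)[OF A0] by (intro sum_mono) auto
      also have "\<dots> = r" using A0 that by (simp add: contingency_tables_def)
      finally show ?thesis .
    qed
    have b_le: "b j \<le> r" if "j \<in> J" for j
    proof -
      have "b j \<le> (\<Sum>i\<in>I. A0 (i, j))"
        unfolding b_def using that K_le(1)[OF A0] by (intro sum_mono) auto
      also have "\<dots> = r" using A0 that by (simp add: contingency_tables_def)
      finally show ?thesis .
    qed
    have sum_a: "sum a I = ?m"
      unfolding a_def using fin by (simp add: sum.cartesian_product)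
    have sum_b: "sum b J = ?m"
      unfolding b_def using fin by (subst sum.swap) (simp add: sum.cartesian_product)
    have m_le: "?m \<le> r * k"
      unfolding sum_a[symmetric] using sum_bounded_above[of I a r] a_le card by (simp add: mult.commute)
    have margins: "(\<Sum>i\<in>I. r - a i) = r * k - ?m" "(\<Sum>j\<in>J. r - b j) = r * k - ?m"
      using a_le b_le card by (simp_all add: sum_subtractf_nat sum_a sum_b mult.commute)
    have inj: "inj_on ?light ?F"
    proof (rule inj_onI)
      fix A B assume A: "A \<in> ?F" and B: "B \<in> ?F" and eq: "?light A = ?light B"
      have "A p = B p" if "p \<in> I \<times> J" for p
        using fun_cong[OF eq, of p] K_le(1)[OF A that] K_le(1)[OF B that] that by auto
      moreover have "A \<in> extensional (I \<times> J)" "B \<in> extensional (I \<times> J)"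
        using A B by (auto simp: contingency_tables_def)
      ultimately show "A = B" by (intro extensionalityI) auto
    qed
    have img: "?light ` ?F \<subseteq> {B \<in> contingency_tables I J (\<lambda>i. r - a i) (\<lambda>j. r - b j). \<forall>p\<in>I \<times> J. B p \<le> 1}"
    proof (intro image_subsetI CollectI conjI)
      fix A assume A: "A \<in> ?F"
      have "(\<Sum>j\<in>J. A (i, j) - K (i, j)) = r - a i" if "i \<in> I" for i
      proof -
        have "(\<Sum>j\<in>J. A (i, j) - K (i, j)) = (\<Sum>j\<in>J. A (i, j)) - a i"
          unfolding a_def using K_le(1)[OF A] that by (intro sum_subtractf_nat) auto
        then show ?thesis using A that by (simp add: contingency_tables_def)
      qed
      moreover have "(\<Sum>i\<in>I. A (i, j) - K (i, j)) = r - b j" if "j \<in> J" for j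
      proof -
        have "(\<Sum>i\<in>I. A (i, j) - K (i, j)) = (\<Sum>i\<in>I. A (i, j)) - b j"
          unfolding b_def using K_le(1)[OF A] that by (intro sum_subtractf_nat) auto
        then show ?thesis using A that by (simp add: contingency_tables_def)
      qed
      ultimately show "?light A \<in> contingency_tables I J (\<lambda>i. r - a i) (\<lambda>j. r - b j)"
        by (simp add: contingency_tables_def)
      show "\<forall>p\<in>I \<times> J. ?light A p \<le> 1"
        using K_le(2)[OF A] by auto
    qed
    have "card ?F \<le> card {B \<in> contingency_tables I J (\<lambda>i. r - a i) (\<lambda>j. r - b j). \<forall>p\<in>I \<times> J. B p \<le> 1}"
      by (rule card_inj_on_le[OF inj img]) (use finite_tables[OF fin] in auto)
    also have "real \<dots> \<le> fact (r * k - ?m) / ((\<Prod>i\<in>I. fact (r - a i)) * (\<Prod>j\<in>J. fact (r - b j)))"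
      using card_zero_one_tables_le[OF fin margins] .
    also have "\<dots> \<le> (exp (real ?m) * fact (r * k) / real (r * k) ^ ?m) /
        ((fact r ^ k / real r ^ ?m) * (fact r ^ k / real r ^ ?m))"
    proof (intro frac_le mult_mono)
      show "fact (r * k - ?m) \<le> exp (real ?m) * fact (r * k) / real (r * k) ^ ?m"
        using fact_diff_le[OF m_le] assms by (simp add: field_simps)
      have "(\<Prod>i\<in>I. fact r / real r ^ a i) \<le> (\<Prod>i\<in>I. fact (r - a i))"
        using fact_le_power_mult_fact_diff[OF a_le] assms by (intro prod_mono) (auto simp: field_simps)
      then show "fact r ^ k / real r ^ ?m \<le> (\<Prod>i\<in>I. fact (r - a i))"
        using card by (simp add: prod_dividef sum_a flip: power_sum)
      have "(\<Prod>j\<in>J. fact r / real r ^ b j) \<le> (\<Prod>j\<in>J. fact (r - b j))"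
        using fact_le_power_mult_fact_diff[OF b_le] assms by (intro prod_mono) (auto simp: field_simps)
      then show "fact r ^ k / real r ^ ?m \<le> (\<Prod>j\<in>J. fact (r - b j))"
        using card by (simp add: prod_dividef sum_b flip: power_sum)
    qed (use assms in \<open>auto intro!: prod_nonneg\<close>)
    also have "\<dots> = fact (r * k) / fact r ^ (2 * k) * (exp 1 * real r / real k) ^ ?m"
    proof -
      have "exp (real ?m) = exp 1 ^ ?m" by (simp flip: exp_of_nat_mult)
      moreover have "(fact r :: real) ^ (2 * k) = fact r ^ k * fact r ^ k"
        by (simp only: mult_2 power_add)
      ultimately show ?thesis
        using assms by (simp add: power_mult_distrib power_divide field_simps)
    qed
    finally show ?thesis by (simp add: power_sum)
  qed
qed

text \<open>The sum over all possible heavy parts is a product over the \<open>k\<^sup>2\<close> cells. As heavy entries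
  start at \<open>2\<close>, each factor is \<open>1 + O(1 / k\<^sup>2)\<close>, so the product stays bounded as
  \<open>k\<close> grows.\<close>

lemma card_regular_tables_le:
  assumes fin: "finite I" "finite J" and card: "card I = k" "card J = k" and pos: "k > 0" "r > 0"
  shows "real (card (contingency_tables I J (\<lambda>_. r) (\<lambda>_. r)))
    \<le> exp (\<Sum>t=2..r. (exp 1 * real r) ^ t) * (fact (r * k) / fact r ^ (2 * k))"
proof -
  let ?T = "contingency_tables I J (\<lambda>_. r) (\<lambda>_. r)"
  let ?H = "I \<times> J \<rightarrow>\<^sub>E insert 0 {2..r}"
  let ?F = "\<lambda>K. {A \<in> ?T. restrict (heavy_part A) (I \<times> J) = K}"
  let ?W = "fact (r * k) / fact r ^ (2 * k) :: real"
  let ?x = "exp 1 * real r / real k"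
  let ?D = "\<Sum>t=2..r. (exp 1 * real r) ^ t"
  have finH: "finite ?H" using fin by (intro finite_PiE) auto
  have "?T \<subseteq> (\<Union>K\<in>?H. ?F K)"
  proof
    fix A assume A: "A \<in> ?T"
    have "A p \<le> r" if "p \<in> I \<times> J" for p
      using tables_le_row[OF A fin(2)] that by auto
    then have "restrict (heavy_part A) (I \<times> J) \<in> ?H"
      by (auto simp: heavy_part_def)
    then show "A \<in> (\<Union>K\<in>?H. ?F K)" using A by blast
  qed
  then have "card ?T \<le> card (\<Union>K\<in>?H. ?F K)"
    by (rule card_mono[rotated]) (use finH finite_tables[OF fin] in auto)
  also have "\<dots> \<le> (\<Sum>K\<in>?H. card (?F K))" by (rule card_UN_le[OF finH])
  finally have "real (card ?T) \<le> real (\<Sum>K\<in>?H. card (?F K))" by linarith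
  also have "\<dots> \<le> (\<Sum>K\<in>?H. ?W * (\<Prod>p\<in>I \<times> J. ?x ^ K p))"
    unfolding of_nat_sum
    by (intro sum_mono card_regular_tables_heavy_part_le assms)
  also have "\<dots> = ?W * (\<Prod>p\<in>I \<times> J. \<Sum>t\<in>insert 0 {2..r}. ?x ^ t)"
    using fin by (subst prod_sum_PiE) (auto simp: sum_distrib_left)
  also have "\<dots> = ?W * (1 + (\<Sum>t=2..r. ?x ^ t)) ^ (k * k)"
    using card by (simp add: card_cartesian_product)
  also have "\<dots> \<le> ?W * exp ?D"
  proof (intro mult_left_mono)
    have "?x ^ t \<le> (exp 1 * real r) ^ t / real (k * k)" if "t \<in> {2..r}" for t
    proof -
      have "real (k * k) \<le> real k ^ t"
        using power_increasing[of 2 t "real k"] that pos by (simp add: power2_eq_square)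
      then show ?thesis
        unfolding power_divide using pos by (intro frac_le) auto
    qed
    then have "(\<Sum>t=2..r. ?x ^ t) \<le> ?D / real (k * k)"
      unfolding sum_divide_distrib by (rule sum_mono)
    then have "1 + (\<Sum>t=2..r. ?x ^ t) \<le> exp (?D / real (k * k))"
      using exp_ge_add_one_self[of "?D / real (k * k)"] by linarith
    then have "(1 + (\<Sum>t=2..r. ?x ^ t)) ^ (k * k) \<le> exp (?D / real (k * k)) ^ (k * k)"
      by (intro power_mono) (auto intro!: add_nonneg_nonneg sum_nonneg)
    also have "\<dots> = exp ?D"
      using pos by (simp flip: exp_of_nat_mult)
    finally show "(1 + (\<Sum>t=2..r. ?x ^ t)) ^ (k * k) \<le> exp ?D" .
  qed auto
  finally show ?thesis by (simp add: mult.commute)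
qed

lemma card_regular_matrices_ge:
  "fact (r * n) / fact r ^ (2 * n) \<le> real (card (regular_matrices n r))"
proof -
  let ?T = "contingency_tables {..<n} {..<n} (\<lambda>_. r) (\<lambda>_. r)"
  have "inj_on (mat n n) ?T"
  proof (rule inj_onI)
    fix A B assume A: "A \<in> ?T" and B: "B \<in> ?T" and eq: "mat n n A = mat n n B"
    have "A p = B p" if "p \<in> {..<n} \<times> {..<n}" for p
      using arg_cong[OF eq, of "\<lambda>M. M $$ p"] that by auto
    then show "A = B"
      using A B by (intro extensionalityI[of A "{..<n} \<times> {..<n}"]) (auto simp: contingency_tables_def)
  qed
  moreover have "mat n n ` ?T \<subseteq> regular_matrices n r"
    by (auto simp: contingency_tables_def regular_matrices_def)
  ultimately have "card ?T \<le> card (regular_matrices n r)"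
    using finite_regular_matrices by (intro card_inj_on_le)
  moreover have "fact (r * n) / fact r ^ (2 * n) \<le> real (card ?T)"
    using card_tables_ge[of "{..<n}" "{..<n}" "\<lambda>_. r" "r * n" "\<lambda>_. r"]
    unfolding mult_2 power_add by (simp add: mult.commute)
  ultimately show ?thesis by linarith
qed

section \<open>Matrices with a proper component\<close>

text \<open>A row in \<open>S\<close> already reaches its full sum \<open>r\<close> inside \<open>T\<close>, and dually for columns.\<close>

lemma component_zero_outside:
  assumes A: "A \<in> regular_matrices n r" and c: "component n r A k S T"
    and ij: "i < n" "j < n" "i \<in> S \<longleftrightarrow> j \<notin> T"
  shows "A $$ (i, j) = 0"
proof (cases "i \<in> S")
  case True
  have "(\<Sum>j<n. A $$ (i, j)) = (\<Sum>j\<in>{..<n} - T. A $$ (i, j)) + (\<Sum>j\<in>T. A $$ (i, j))"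
    using c by (intro sum.subset_diff) (auto simp: component_def)
  then have "(\<Sum>j\<in>{..<n} - T. A $$ (i, j)) = 0"
    using A c True ij by (auto simp: component_def regular_matrices_def)
  then show ?thesis using True ij by auto
next
  case False
  have "(\<Sum>i<n. A $$ (i, j)) = (\<Sum>i\<in>{..<n} - S. A $$ (i, j)) + (\<Sum>i\<in>S. A $$ (i, j))"
    using c by (intro sum.subset_diff) (auto simp: component_def)
  then have "(\<Sum>i\<in>{..<n} - S. A $$ (i, j)) = 0"
    using A c False ij by (auto simp: component_def regular_matrices_def)
  then show ?thesis using False ij by auto
qed

text \<open>Up to the order of rows and columns such a matrix is block diagonal, with blocks that are again \<open>r\<close>-regular, and is determined by
  its two blocks.\<close>

lemma card_matrices_with_component_le:
  "card {A \<in> regular_matrices n r. component n r A k S T}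
    \<le> card (contingency_tables S T (\<lambda>_. r) (\<lambda>_. r)) *
      card (contingency_tables ({..<n} - S) ({..<n} - T) (\<lambda>_. r) (\<lambda>_. r))"
proof (cases "S \<subseteq> {..<n} \<and> T \<subseteq> {..<n}")
  case False
  then have "{A \<in> regular_matrices n r. component n r A k S T} = {}"
    by (auto simp: component_def)
  then show ?thesis by (simp only: card.empty le0)
next
  case True
  then have sub: "S \<subseteq> {..<n}" "T \<subseteq> {..<n}" by auto
  have fin: "finite S" "finite T" using sub finite_subset by auto
  let ?U = "{..<n}"
  let ?B = "{A \<in> regular_matrices n r. component n r A k S T}"
  let ?f = "\<lambda>A :: nat mat. (restrict (($$) A) (S \<times> T), restrict (($$) A) ((?U - S) \<times> (?U - T)))"
  have "inj_on ?f ?B"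
  proof (rule inj_onI)
    fix A B assume A: "A \<in> ?B" and B: "B \<in> ?B" and eq: "?f A = ?f B"
    have "A $$ (i, j) = B $$ (i, j)" if ij: "i < n" "j < n" for i j
    proof (cases "i \<in> S \<longleftrightarrow> j \<in> T")
      case True
      have "restrict (($$) A) (S \<times> T) = restrict (($$) B) (S \<times> T)"
        "restrict (($$) A) ((?U - S) \<times> (?U - T)) = restrict (($$) B) ((?U - S) \<times> (?U - T))"
        using eq by simp_all
      from this[THEN fun_cong, of "(i, j)"] show ?thesis
        using ij True by (cases "i \<in> S") auto
    next
      case False
      then have "A $$ (i, j) = 0" "B $$ (i, j) = 0"
        using A B ij component_zero_outside[of A n r k S T i j]
          component_zero_outside[of B n r k S T i j] by blast+
      then show ?thesis by simp
    qed
    then show "A = B"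
      using A B by (intro eq_matI) (auto simp: regular_matrices_def)
  qed
  moreover have "?f ` ?B \<subseteq> contingency_tables S T (\<lambda>_. r) (\<lambda>_. r) \<times> contingency_tables (?U - S) (?U - T) (\<lambda>_. r) (\<lambda>_. r)"
  proof (intro image_subsetI SigmaI)
    fix A assume A: "A \<in> ?B"
    then have "A \<in> regular_matrices n r" "component n r A k S T" by auto
    note zero = component_zero_outside[OF this]
    show "restrict (($$) A) (S \<times> T) \<in> contingency_tables S T (\<lambda>_. r) (\<lambda>_. r)"
      using A by (auto simp: contingency_tables_def component_def)
    have "(\<Sum>j\<in>?U - T. A $$ (i, j)) = r" if i: "i \<in> ?U - S" for i
    proof -
      have "A $$ (i, j) = 0" if "j \<in> T" for j
        using zero[of i j] i that sub by blast
      then have "(\<Sum>j\<in>?U - T. A $$ (i, j)) = (\<Sum>j\<in>?U. A $$ (i, j))"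
        by (intro sum.mono_neutral_left) auto
      then show ?thesis using A i by (simp add: regular_matrices_def)
    qed
    moreover have "(\<Sum>i\<in>?U - S. A $$ (i, j)) = r" if j: "j \<in> ?U - T" for j
    proof -
      have "A $$ (i, j) = 0" if "i \<in> S" for i
        using zero[of i j] j that sub by blast
      then have "(\<Sum>i\<in>?U - S. A $$ (i, j)) = (\<Sum>i\<in>?U. A $$ (i, j))"
        by (intro sum.mono_neutral_left) auto
      then show ?thesis using A j by (simp add: regular_matrices_def)
    qed
    ultimately show "restrict (($$) A) ((?U - S) \<times> (?U - T)) \<in> contingency_tables (?U - S) (?U - T) (\<lambda>_. r) (\<lambda>_. r)"
      by (simp add: contingency_tables_def)
  qed
  ultimately have "card ?B \<le> card (contingency_tables S T (\<lambda>_. r) (\<lambda>_. r) \<times> contingency_tables (?U - S) (?U - T) (\<lambda>_. r) (\<lambda>_. r))"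
    using fin by (intro card_inj_on_le) (auto intro!: finite_cartesian_product finite_tables)
  then show ?thesis by (simp add: card_cartesian_product)
qed

lemma least_component_size_cases:
  assumes "A \<in> regular_matrices n r" "n \<ge> 1" "least_component_size n r A \<noteq> n"
  obtains k S T where "1 \<le> k" "k < n" "component n r A k S T"
proof -
  let ?k = "least_component_size n r A"
  have "?k \<in> {k. 1 \<le> k \<and> num_irreducible_components n r k A > 0}"
    unfolding least_component_size_def
    by (intro Inf_nat_def1 irreducible_component_sizes_nonempty assms)
  then have k: "1 \<le> ?k" "num_irreducible_components n r ?k A > 0" by auto
  then have "{(S, T). irreducible_component n r A ?k S T} \<noteq> {}"
    by (metis card.empty less_numeral_extra(3) num_irreducible_components_def)
  then obtain S T where c: "component n r A ?k S T"
    by (auto simp: irreducible_component_def)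
  then have "S \<subseteq> {..<n}" "card S = ?k" by (auto simp: component_def)
  then have "?k \<le> n" using card_mono[of "{..<n}" S] by simp
  then show ?thesis using that[OF k(1) _ c] assms(3) by simp
qed

section \<open>Binomial estimates\<close>

text \<open>One term of the Vandermonde convolution.\<close>

lemma binomial_mult_le: "(a choose b) * (c choose d) \<le> (a + c) choose (b + d)"
proof -
  have "(a choose b) * (c choose (b + d - b)) \<le> (\<Sum>k\<le>b + d. (a choose k) * (c choose (b + d - k)))"
    by (intro member_le_sum) auto
  then show ?thesis by (simp add: vandermonde)
qed

lemma binomial_power_le: "(n choose k) ^ r \<le> (r * n) choose (r * k)"
proof (induction r)
  case (Suc r)
  have "(n choose k) ^ Suc r \<le> (n choose k) * ((r * n) choose (r * k))"
    using Suc by simp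
  also have "\<dots> \<le> (Suc r * n) choose (Suc r * k)"
    using binomial_mult_le[of n k "r * n" "r * k"] by simp
  finally show ?case .
qed simp

text \<open>The terms \<open>k = 1\<close> and \<open>k = n - 1\<close> are \<open>1 / n\<close> each, and the fewer than
  \<open>n\<close> others are at most \<open>1 / (n choose 2)\<close>, hence contribute only another
  \<open>2 / n\<close>.\<close>

lemma sum_inverse_binomial_le:
  assumes "n \<ge> 2"
  shows "(\<Sum>k=1..<n. 1 / real (n choose k)) \<le> 4 / real n"
proof -
  have ge: "real n * (real n - 1) / 2 \<le> real (n choose k)" if "2 \<le> k" "k \<le> n - 2" "4 \<le> n" for k
  proof -
    have "n choose 2 \<le> n choose k"
    proof (cases "2 * k \<le> n")
      case True
      then show ?thesis using that by (intro binomial_mono) auto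
    next
      case False
      have "n choose 2 \<le> n choose (n - k)"
        using False that by (intro binomial_mono) auto
      then show ?thesis using that by (simp flip: binomial_symmetric)
    qed
    moreover have "real (n choose 2) = real n * (real n - 1) / 2"
      using assms by (simp add: choose_two real_of_nat_div of_nat_diff)
    ultimately show ?thesis by (metis of_nat_le_iff)
  qed
  have bound: "1 / real (n choose k) \<le>
      (if k = 1 then 1 / real n else 0) + (if k = n - 1 then 1 / real n else 0)
        + 2 / (real n * (real n - 1))" if k: "k \<in> {1..<n}" for k
  proof -
    consider "k = 1" | "k = n - 1" | "2 \<le> k" "k \<le> n - 2" "4 \<le> n" using k by fastforce
    then show ?thesis
    proof cases
      case 2
      then have "n choose k = n" using assms binomial_symmetric[of 1 n] by simp
      then show ?thesis using 2 assms by simp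
    next
      case 3
      have "1 / real (n choose k) \<le> 1 / (real n * (real n - 1) / 2)"
        using ge[OF 3] 3 by (intro divide_left_mono mult_pos_pos) (auto simp: zero_less_binomial_iff)
      then have "1 / real (n choose k) \<le> 2 / (real n * (real n - 1))" by simp
      moreover have "k \<noteq> 1" "k \<noteq> n - 1" using 3 by auto
      ultimately show ?thesis by simp
    qed (use assms in simp)
  qed
  have "(\<Sum>k=1..<n. 1 / real (n choose k)) \<le> (\<Sum>k=1..<n.
      (if k = 1 then 1 / real n else 0) + (if k = n - 1 then 1 / real n else 0)
        + 2 / (real n * (real n - 1)))"
    by (intro sum_mono bound)
  also have "\<dots> = 1 / real n + 1 / real n + real (n - 1) * (2 / (real n * (real n - 1)))"
    using assms by (simp add: sum.distrib)
  also have "\<dots> = 4 / real n"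
    using assms by (simp add: of_nat_diff field_simps)
  finally show ?thesis .
qed

text \<open>After division by the first fraction on the right, the powers of \<open>fact r\<close> cancel and
  the remaining factorials form \<open>1 / (r n choose r k)\<close>, which is at most \<open>1 / (n choose k)\<^sup>r\<close>. The exponent \<open>r \<ge> 3\<close> beats the square
  coming from the choice of the two index sets.\<close>

lemma component_count_ratio_le:
  assumes "r \<ge> 3" "k \<le> n"
  shows "real (n choose k) ^ 2 * (fact (r * k) / fact r ^ (2 * k)) *
      (fact (r * (n - k)) / fact r ^ (2 * (n - k)))
    \<le> fact (r * n) / fact r ^ (2 * n) / real (n choose k)"
proof -
  let ?b = "real (n choose k)"
  have b: "?b \<ge> 1" using assms by (simp add: Suc_le_eq zero_less_binomial_iff)
  have "?b ^ 3 \<le> ?b ^ r" using b assms by (intro power_increasing)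
  also have "\<dots> \<le> real ((r * n) choose (r * k))"
    using binomial_power_le[of n k r] by (metis of_nat_le_iff of_nat_power)
  also have "\<dots> = fact (r * n) / (fact (r * k) * fact (r * (n - k)))"
    using assms by (subst binomial_fact) (auto simp: diff_mult_distrib2)
  finally have "?b ^ 3 * (fact (r * k) * fact (r * (n - k))) \<le> fact (r * n)"
    by (simp add: field_simps)
  then have "?b ^ 2 * (fact (r * k) * fact (r * (n - k))) * ?b \<le> fact (r * n)"
    by (simp add: power3_eq_cube power2_eq_square mult_ac)
  moreover have "?b > 0" using b by linarith
  ultimately have "?b ^ 2 * (fact (r * k) * fact (r * (n - k))) \<le> fact (r * n) / ?b"
    by (simp only: pos_le_divide_eq)
  then have "?b ^ 2 * (fact (r * k) * fact (r * (n - k))) / fact r ^ (2 * n)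
      \<le> fact (r * n) / ?b / fact r ^ (2 * n)"
    by (intro divide_right_mono) auto
  moreover have "(fact r :: real) ^ (2 * n) = fact r ^ (2 * k) * fact r ^ (2 * (n - k))"
  proof -
    have "2 * n = 2 * k + 2 * (n - k)" using assms by simp
    then show ?thesis by (metis power_add)
  qed
  ultimately show ?thesis by (simp add: mult_ac)
qed

section \<open>Connectedness with high probability\<close>

text \<open>Union bound over all proper pairs \<open>(S, T)\<close>. Each of the two blocks is bounded above with
  a factor \<open>C\<close>, the number of all matrices is bounded below without loss.\<close>

lemma card_matrices_with_small_component_le:
  assumes "r \<ge> 3" "n \<ge> 2"
  defines "C \<equiv> exp (\<Sum>t=2..r. (exp 1 * real r) ^ t)"
  shows "real (card {A \<in> regular_matrices n r. least_component_size n r A \<noteq> n})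
    \<le> 4 * C ^ 2 / real n * real (card (regular_matrices n r))"
proof -
  let ?M = "regular_matrices n r"
  let ?P = "\<lambda>k. {S. S \<subseteq> {..<n} \<and> card S = k}"
  let ?W = "\<lambda>k. fact (r * k) / fact r ^ (2 * k) :: real"
  let ?B = "\<lambda>k S T. {A \<in> ?M. component n r A k S T}"
  have finP: "finite (?P k)" for k by (rule finite_subset[of _ "Pow {..<n}"]) auto
  have C: "C > 0" by (simp add: C_def)
  have cell: "real (card (?B k S T)) \<le> C ^ 2 * (?W k * ?W (n - k))"
    if k: "k \<in> {1..<n}" and ST: "S \<in> ?P k" "T \<in> ?P k" for k S T
  proof -
    have fin: "finite S" "finite T" using ST finite_subset by auto
    have "real (card (?B k S T)) \<le> real (card (contingency_tables S T (\<lambda>_. r) (\<lambda>_. r))) *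
        real (card (contingency_tables ({..<n} - S) ({..<n} - T) (\<lambda>_. r) (\<lambda>_. r)))"
      using card_matrices_with_component_le[of n r k S T] by (simp only: of_nat_le_iff flip: of_nat_mult)
    also have "\<dots> \<le> (C * ?W k) * (C * ?W (n - k))"
      unfolding C_def using ST k fin assms(1)
      by (intro mult_mono card_regular_tables_le) (auto simp: card_Diff_subset)
    finally show ?thesis by (simp add: power2_eq_square mult_ac)
  qed
  have "{A \<in> ?M. least_component_size n r A \<noteq> n} \<subseteq> (\<Union>k\<in>{1..<n}. \<Union>S\<in>?P k. \<Union>T\<in>?P k. ?B k S T)"
  proof
    fix A assume A: "A \<in> {A \<in> ?M. least_component_size n r A \<noteq> n}"
    then obtain k S T where "1 \<le> k" "k < n" "component n r A k S T"
      using least_component_size_cases[of A n r] assms(2) by auto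
    then have "k \<in> {1..<n}" "S \<in> ?P k" "T \<in> ?P k" "A \<in> ?B k S T"
      using A by (auto simp: component_def)
    then show "A \<in> (\<Union>k\<in>{1..<n}. \<Union>S\<in>?P k. \<Union>T\<in>?P k. ?B k S T)" by blast
  qed
  then have "card {A \<in> ?M. least_component_size n r A \<noteq> n} \<le> card (\<Union>k\<in>{1..<n}. \<Union>S\<in>?P k. \<Union>T\<in>?P k. ?B k S T)"
    by (rule card_mono[rotated]) (auto simp: finP finite_regular_matrices)
  also have "\<dots> \<le> (\<Sum>k=1..<n. \<Sum>S\<in>?P k. \<Sum>T\<in>?P k. card (?B k S T))"
    by (intro order_trans[OF card_UN_le] sum_mono finP order_refl finite_atLeastLessThan)
  finally have "real (card {A \<in> ?M. least_component_size n r A \<noteq> n})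
      \<le> real (\<Sum>k=1..<n. \<Sum>S\<in>?P k. \<Sum>T\<in>?P k. card (?B k S T))"
    by linarith
  also have "\<dots> \<le> (\<Sum>k=1..<n. \<Sum>S\<in>?P k. \<Sum>T\<in>?P k. C ^ 2 * (?W k * ?W (n - k)))"
    unfolding of_nat_sum by (intro sum_mono cell)
  also have "\<dots> = (\<Sum>k=1..<n. C ^ 2 * (real (n choose k) ^ 2 * ?W k * ?W (n - k)))"
    using n_subsets[of "{..<n}"] by (simp add: power2_eq_square mult_ac)
  also have "\<dots> \<le> (\<Sum>k=1..<n. C ^ 2 * (?W n / real (n choose k)))"
    by (intro sum_mono mult_left_mono component_count_ratio_le assms) auto
  also have "\<dots> = C ^ 2 * ?W n * (\<Sum>k=1..<n. 1 / real (n choose k))"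
    by (simp add: sum_distrib_left)
  also have "\<dots> \<le> C ^ 2 * real (card ?M) * (4 / real n)"
    by (intro mult_mono card_regular_matrices_ge sum_inverse_binomial_le assms) (auto intro!: sum_nonneg)
  finally show ?thesis by (simp add: mult_ac)
qed

theorem theorem2p6:
  fixes r :: nat
  assumes "r \<ge> 3"
  shows "(\<lambda>n. measure_pmf.prob (pmf_of_set (regular_matrices n r))
            {A. least_component_size n r A = n}) \<longlonglongrightarrow> 1"
proof -
  let ?C = "exp (\<Sum>t=2..r. (exp 1 * real r) ^ t)"
  let ?p = "\<lambda>n. measure_pmf.prob (pmf_of_set (regular_matrices n r))
    {A. least_component_size n r A = n}"
  have lower: "1 - 4 * ?C ^ 2 / real n \<le> ?p n" if n: "n \<ge> 2" for n
  proof -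
    let ?M = "regular_matrices n r"
    let ?bad = "{A \<in> ?M. least_component_size n r A \<noteq> n}"
    have M: "finite ?M" "?M \<noteq> {}"
      by (rule finite_regular_matrices, rule regular_matrices_nonempty)
    have "?M \<inter> {A. least_component_size n r A = n} = ?M - ?bad" by auto
    then have "?p n = real (card (?M - ?bad)) / real (card ?M)"
      using measure_pmf_of_set[OF M(2,1)] by simp
    also have "card (?M - ?bad) = card ?M - card ?bad"
      using M by (intro card_Diff_subset) auto
    also have "real \<dots> = real (card ?M) - real (card ?bad)"
      using M by (intro of_nat_diff card_mono) auto
    finally have "?p n = 1 - real (card ?bad) / real (card ?M)"
      using M by (simp add: diff_divide_distrib)
    moreover have "real (card ?bad) / real (card ?M) \<le> 4 * ?C ^ 2 / real n"
      using card_matrices_with_small_component_le[OF assms n] M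
      by (simp add: divide_le_eq card_gt_0_iff)
    ultimately show ?thesis by linarith
  qed
  show ?thesis
  proof (rule tendsto_sandwich)
    show "\<forall>\<^sub>F n in sequentially. 1 - 4 * ?C ^ 2 / real n \<le> ?p n"
      using eventually_ge_at_top[of 2] by eventually_elim (rule lower)
    show "\<forall>\<^sub>F n in sequentially. ?p n \<le> 1" by simp
    show "(\<lambda>n. 1 - 4 * ?C ^ 2 / real n) \<longlonglongrightarrow> 1"
      using tendsto_diff[OF tendsto_const lim_const_over_n[of "4 * ?C ^ 2"], of 1] by simp
  qed simp
qed

end
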